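(* For all integers $m\ge 1$, $n\ge 1$ and $k_1,\ldots,k_m\ge 1$, $$t(M^{k_1,k_2,\ldots,k_m}K_{m,n})=n^{m-1}\,k_1k_2\cdots k_m\,(k_1+k_2+\cdots+k_m)^{n-1}.$$
   Context: Graphs may have multiple edges; $t(G)$ denotes the number of spanning trees of $G$, with parallel edges distinguished. The generalized complete bipartite graph $M^{k_1,\ldots,k_m}K_{m,n}$ has vertex set $V_1\cup V_2$ with $V_1=\{p_1,\ldots,p_n\}$ and $V_2=\{q_1,\ldots,q_m\}$, and for each $i\in\{1,\ldots,m\}$ and $j\in\{1,\ldots,n\}$ the vertices $q_i$ and $p_j$ are joined by exactly $k_i$ parallel edges; there are no other edges. *)

theory Defs
  imports Main
begin

text \<open>
  Undirected multigraphs: edges are named objects, so parallel edges are distinct edges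
  with the same set of ends (a loop has a singleton set of ends).
\<close>

record ('v, 'e) multigraph =
  mg_verts :: "'v set"
  mg_edges :: "'e set"
  mg_ends :: "'e \<Rightarrow> 'v set"

definition mg_wf :: "('v, 'e) multigraph \<Rightarrow> bool" where
  "mg_wf G \<longleftrightarrow>
     (\<forall>e\<in>mg_edges G. mg_ends G e \<subseteq> mg_verts G \<and> card (mg_ends G e) \<in> {1, 2})"

definition mg_adj :: "('v, 'e) multigraph \<Rightarrow> ('v \<times> 'v) set" where
  "mg_adj G = {(u, v). \<exists>e\<in>mg_edges G. mg_ends G e = {u, v}}"

definition mg_connected :: "('v, 'e) multigraph \<Rightarrow> bool" where
  "mg_connected G \<longleftrightarrow>
     mg_verts G \<noteq> {} \<and> (\<forall>u\<in>mg_verts G. \<forall>v\<in>mg_verts G. (u, v) \<in> (mg_adj G)\<^sup>*)"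

text \<open>
  A cycle visits the distinct vertices \<open>vs\<close> in cyclic order along the distinct edges \<open>es\<close>.
  Length 1 is a loop, and length 2 is a pair of parallel edges.
\<close>

definition mg_cycle :: "('v, 'e) multigraph \<Rightarrow> 'v list \<Rightarrow> 'e list \<Rightarrow> bool" where
  "mg_cycle G vs es \<longleftrightarrow>
     es \<noteq> [] \<and> length vs = length es \<and> distinct vs \<and> distinct es \<and>
     set vs \<subseteq> mg_verts G \<and> set es \<subseteq> mg_edges G \<and>
     (\<forall>i<length es. mg_ends G (es ! i) = {vs ! i, vs ! (Suc i mod length es)})"

definition mg_acyclic :: "('v, 'e) multigraph \<Rightarrow> bool" where
  "mg_acyclic G \<longleftrightarrow> (\<nexists>vs es. mg_cycle G vs es)"

definition mg_tree :: "('v, 'e) multigraph \<Rightarrow> bool" where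
  "mg_tree G \<longleftrightarrow> mg_connected G \<and> mg_acyclic G"

text \<open>A spanning tree keeps all vertices, so it is determined by its set of edges.\<close>

definition spanning_trees :: "('v, 'e) multigraph \<Rightarrow> 'e set set" where
  "spanning_trees G = {F. F \<subseteq> mg_edges G \<and> mg_tree (G\<lparr>mg_edges := F\<rparr>)}"

definition num_spanning_trees :: "('v, 'e) multigraph \<Rightarrow> nat" where
  "num_spanning_trees G = card (spanning_trees G)"

datatype bivertex = PVert nat | QVert nat

text \<open>The triple \<open>(i, j, l)\<close> is the \<open>l\<close>-th of the \<open>k i\<close> parallel edges joining \<open>q\<^sub>i\<close> and \<open>p\<^sub>j\<close>.\<close>

definition gen_complete_bipartite ::
  "(nat \<Rightarrow> nat) \<Rightarrow> nat \<Rightarrow> nat \<Rightarrow> (bivertex, nat \<times> nat \<times> nat) multigraph" where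
  "gen_complete_bipartite k m n =
     \<lparr>mg_verts = PVert ` {1..n} \<union> QVert ` {1..m},
      mg_edges = {(i, j, l). i \<in> {1..m} \<and> j \<in> {1..n} \<and> l \<in> {1..k i}},
      mg_ends = (\<lambda>(i, j, l). {QVert i, PVert j})\<rparr>"

lemma mg_wf_gen_complete_bipartite: "mg_wf (gen_complete_bipartite k m n)"
  by (auto simp: mg_wf_def gen_complete_bipartite_def)

lemma card_parallel_edges:
  assumes "i \<in> {1..m}" "j \<in> {1..n}"
  shows "card {e \<in> mg_edges (gen_complete_bipartite k m n).
                 mg_ends (gen_complete_bipartite k m n) e = {QVert i, PVert j}} = k i"
proof -
  have "{e \<in> mg_edges (gen_complete_bipartite k m n).
           mg_ends (gen_complete_bipartite k m n) e = {QVert i, PVert j}}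
        = (\<lambda>l. (i, j, l)) ` {1..k i}"
    using assms by (auto simp: gen_complete_bipartite_def doubleton_eq_iff)
  then show ?thesis
    by (simp add: card_image inj_on_def)
qed

end

theory Submission
  imports Defs "HOL-Library.FuncSet"
begin

text \<open>
  Fix a root and split the other vertices of a spanning tree by their distance from it. Removing the
  root leaves a spanning forest rooted at the first layer, so the number of spanning forests with a
  prescribed root set \<open>R\<close> obeys a recursion over the possible first layers. For complete bipartite
  multigraphs whose multiplicities are products of vertex weights, the layers alternate between the
  sides, and an Abel-type binomial identity shows that the recursion is solved by a product formula.

  Spanning is expressed by cuts: every nonempty set of non-root vertices is left by some edge. Forests
  are the spanning edge sets with as many edges as there are non-root vertices; this avoids
  manipulating paths, which only enter when trees are compared with rooted forests.
\<close>

section \<open>Rooted spanning forests\<close>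

text \<open>Equivalent to joining every vertex of \<open>X\<close> to \<open>R\<close> by a path in
  \<open>F\<close> within \<open>R \<union> X\<close>: otherwise the vertices of \<open>X\<close>
  not so joined would form a set that no edge leaves.\<close>

definition spans :: "('v, 'e) multigraph \<Rightarrow> 'v set \<Rightarrow> 'v set \<Rightarrow> 'e set \<Rightarrow> bool" where
  "spans G R X F \<longleftrightarrow>
     (\<forall>A\<subseteq>X. A \<noteq> {} \<longrightarrow> (\<exists>e\<in>F. \<exists>a\<in>A. \<exists>b\<in>(R \<union> X) - A. mg_ends G e = {a, b}))"

text \<open>For finite \<open>X\<close> disjoint from \<open>R\<close>, \<open>card X\<close> is the
  least size of a spanning edge set, so the size condition replaces acyclicity and puts exactly one
  root into each component.\<close>

definition rooted_forests :: "('v, 'e) multigraph \<Rightarrow> 'v set \<Rightarrow> 'v set \<Rightarrow> 'e set set" where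
  "rooted_forests G R X =
     {F. F \<subseteq> mg_edges G \<and> (\<forall>e\<in>F. mg_ends G e \<subseteq> R \<union> X) \<and> card F = card X \<and> spans G R X F}"

definition edges_into :: "('v, 'e) multigraph \<Rightarrow> 'v set \<Rightarrow> 'v \<Rightarrow> 'e set" where
  "edges_into G R v = {e \<in> mg_edges G. \<exists>u\<in>R. mg_ends G e = {u, v}}"

definition first_layer :: "('v, 'e) multigraph \<Rightarrow> 'v set \<Rightarrow> 'v set \<Rightarrow> 'e set \<Rightarrow> 'v set" where
  "first_layer G R X F = {v \<in> X. F \<inter> edges_into G R v \<noteq> {}}"

lemma edges_into_ends:
  assumes "e \<in> edges_into G R v" "v \<in> X" "R \<inter> X = {}"
  shows "mg_ends G e \<inter> X = {v}" "\<not> mg_ends G e \<subseteq> X" "mg_ends G e \<subseteq> R \<union> X"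
  using assms by (auto simp: edges_into_def)

text \<open>An edge from a non-root to a root puts its non-root end into the first layer. So an edge
  leaving a set that avoids the layer has both ends in \<open>X\<close>.\<close>

lemma spans_first_layer:
  assumes "spans G R X F" "F \<subseteq> mg_edges G"
  defines "S \<equiv> first_layer G R X F"
  shows "spans G S (X - S) {e \<in> F. mg_ends G e \<subseteq> X}"
  unfolding spans_def
proof (intro allI impI)
  fix A assume A: "A \<subseteq> X - S" "A \<noteq> {}"
  then obtain e a b where e: "e \<in> F" "a \<in> A" "b \<in> (R \<union> X) - A" "mg_ends G e = {a, b}"
    using assms(1) unfolding spans_def by (meson Diff_subset subset_trans)
  have "b \<notin> R"
  proof
    assume "b \<in> R"
    then have "a \<in> S"
      using e A assms(2) by (auto simp: S_def first_layer_def edges_into_def insert_commute)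
    then show False using e A by auto
  qed
  then have "e \<in> {e \<in> F. mg_ends G e \<subseteq> X}" "b \<in> (S \<union> (X - S)) - A"
    using e A by auto
  then show "\<exists>e\<in>{e \<in> F. mg_ends G e \<subseteq> X}. \<exists>a\<in>A. \<exists>b\<in>(S \<union> (X - S)) - A. mg_ends G e = {a, b}"
    using e by blast
qed

text \<open>The inverse of removing the roots: \<open>c\<close> picks one root edge for each vertex
  of the layer \<open>S\<close>, and the sizes add up to
  \<open>card S + card (X - S)\<close>.\<close>

lemma rooted_forests_attach:
  assumes "R \<inter> X = {}" "S \<subseteq> X" "finite X" "finite (mg_edges G)"
    and c: "c \<in> (\<Pi>\<^sub>E v\<in>S. edges_into G R v)" and F: "F \<in> rooted_forests G S (X - S)"
  shows "c ` S \<union> F \<in> rooted_forests G R X"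
proof -
  have cin: "c v \<in> edges_into G R v" if "v \<in> S" for v using c that by auto
  note ends = edges_into_ends[OF cin _ assms(1)]
  have FX: "mg_ends G e \<subseteq> X" if "e \<in> F" for e
    using F that assms(2) by (auto simp: rooted_forests_def)
  have sub: "c ` S \<union> F \<subseteq> mg_edges G"
    using cin F by (auto simp: rooted_forests_def edges_into_def)
  \<comment> \<open>The unique end of \<open>c v\<close> in \<open>X\<close> is \<open>v\<close>, so
    the edge determines the vertex.\<close>
  have "inj_on c S"
  proof (rule inj_onI)
    fix x y assume "x \<in> S" "y \<in> S" "c x = c y"
    then show "x = y" using ends(1)[of x] ends(1)[of y] assms(2) by auto
  qed
  moreover have "c ` S \<inter> F = {}" using ends(2) FX assms(2) by blast
  moreover have "finite F" "finite S"
    using sub assms finite_subset by auto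
  ultimately have "card (c ` S \<union> F) = card S + card (X - S)"
    using F by (simp add: card_Un_disjoint card_image rooted_forests_def)
  also have "\<dots> = card X"
    using assms \<open>finite S\<close> by (simp add: card_Diff_subset card_mono)
  finally have card: "card (c ` S \<union> F) = card X" .
  have "spans G R X (c ` S \<union> F)"
    unfolding spans_def
  proof (intro allI impI)
    fix A assume A: "A \<subseteq> X" "A \<noteq> {}"
    \<comment> \<open>A set missing the layer is left by an edge of \<open>F\<close>; a set
      containing some \<open>v\<close> of the layer is left by \<open>c v\<close>, which ends at a
      root.\<close>
    show "\<exists>e\<in>c ` S \<union> F. \<exists>a\<in>A. \<exists>b\<in>(R \<union> X) - A. mg_ends G e = {a, b}"
    proof (cases "A \<inter> S = {}")
      case True
      then have AS: "A \<subseteq> X - S" using A by auto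
      have "spans G S (X - S) F" using F by (simp add: rooted_forests_def)
      then obtain e a b where "e \<in> F" "a \<in> A" "b \<in> (S \<union> (X - S)) - A" "mg_ends G e = {a, b}"
        unfolding spans_def using AS A(2) by meson
      then show ?thesis using assms(2) by blast
    next
      case False
      then obtain v where v: "v \<in> A" "v \<in> S" by auto
      then obtain u where "u \<in> R" "mg_ends G (c v) = {v, u}"
        using cin[of v] by (auto simp: edges_into_def)
      then show ?thesis using v A assms(1) by blast
    qed
  qed
  then show ?thesis
    using sub card ends(3) FX assms(2) by (auto simp: rooted_forests_def)
qed

lemma first_layer_choice:
  obtains c where "c \<in> (\<Pi>\<^sub>E v\<in>first_layer G R X F. edges_into G R v)" "c ` first_layer G R X F \<subseteq> F"
proof -
  have "\<forall>v\<in>first_layer G R X F. \<exists>e. e \<in> F \<inter> edges_into G R v"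
    by (auto simp: first_layer_def)
  then obtain c where c: "\<forall>v\<in>first_layer G R X F. c v \<in> F \<inter> edges_into G R v"
    by (rule bchoice[elim_format]) blast
  show thesis
    by (rule that[of "restrict c (first_layer G R X F)"]) (use c in auto)
qed

text \<open>Keep one root edge for each vertex of the first layer, discard the other root edges, and
  recurse with the layer as the new root set.\<close>

lemma spans_contains_rooted_forest:
  assumes "spans G R X F" "F \<subseteq> mg_edges G" "R \<inter> X = {}" "finite X" "finite (mg_edges G)"
  obtains F0 where "F0 \<subseteq> F" "F0 \<in> rooted_forests G R X"
  using assms
proof (induction "card X" arbitrary: R X F thesis rule: less_induct)
  case less
  show ?case
  proof (cases "X = {}")
    case True
    then show ?thesis
      using less.prems(1)[of "{}"] by (auto simp: rooted_forests_def spans_def)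
  next
    case False
    define S where "S = first_layer G R X F"
    \<comment> \<open>The cut with \<open>A = X\<close> shows that the first layer is nonempty, so
      the recursion is on a smaller set.\<close>
    obtain e a b where "e \<in> F" "a \<in> X" "b \<in> (R \<union> X) - X" "mg_ends G e = {a, b}"
      using False less.prems(2) unfolding spans_def by blast
    then have "a \<in> X" "e \<in> F \<inter> edges_into G R a"
      using less.prems(3) by (auto simp: edges_into_def)
    then have "a \<in> S" by (auto simp: S_def first_layer_def)
    have SX: "S \<subseteq> X" by (auto simp: S_def first_layer_def)
    then have less_card: "card (X - S) < card X"
      using \<open>a \<in> S\<close> less.prems(5) by (auto intro: psubset_card_mono)
    obtain F1 where F1: "F1 \<subseteq> {e \<in> F. mg_ends G e \<subseteq> X}" "F1 \<in> rooted_forests G S (X - S)"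
      by (rule less.hyps[OF less_card _ spans_first_layer[OF less.prems(2,3), folded S_def]])
        (use less.prems in auto)
    obtain c where "c \<in> (\<Pi>\<^sub>E v\<in>S. edges_into G R v)" "c ` S \<subseteq> F"
      using first_layer_choice unfolding S_def by blast
    then show ?thesis
      using less.prems(1)[of "c ` S \<union> F1"] F1(1)
        rooted_forests_attach[OF less.prems(4) SX less.prems(5,6) _ F1(2)] by blast
  qed
qed

lemma card_le_card_spans:
  assumes "spans G R X F" "F \<subseteq> mg_edges G" "R \<inter> X = {}" "finite X" "finite (mg_edges G)"
  shows "card X \<le> card F"
proof -
  obtain F0 where "F0 \<subseteq> F" "F0 \<in> rooted_forests G R X"
    using spans_contains_rooted_forest[OF assms] .
  moreover have "finite F" using assms finite_subset by blast
  ultimately show ?thesis by (metis (mono_tags, lifting) card_mono mem_Collect_eq rooted_forests_def)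
qed

lemma rooted_forests_eq_attached:
  assumes "R \<inter> X = {}" "finite X" "finite (mg_edges G)"
  shows "rooted_forests G R X =
    (\<lambda>(S, c, F). c ` S \<union> F) `
      (SIGMA S:Pow X. (\<Pi>\<^sub>E v\<in>S. edges_into G R v) \<times> rooted_forests G S (X - S))"
    (is "_ = ?f ` ?D")
proof
  show "?f ` ?D \<subseteq> rooted_forests G R X"
    using rooted_forests_attach[OF assms(1) _ assms(2,3)] by auto
next
  show "rooted_forests G R X \<subseteq> ?f ` ?D"
  proof
    fix F assume F: "F \<in> rooted_forests G R X"
    then have FG: "F \<subseteq> mg_edges G" and sp: "spans G R X F" and cF: "card F = card X"
      by (auto simp: rooted_forests_def)
    define S where "S = first_layer G R X F"
    have SX: "S \<subseteq> X" by (auto simp: S_def first_layer_def)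
    obtain F1 where F1: "F1 \<subseteq> {e \<in> F. mg_ends G e \<subseteq> X}" "F1 \<in> rooted_forests G S (X - S)"
      using spans_contains_rooted_forest[OF spans_first_layer[OF sp FG]] FG assms
      unfolding S_def by blast
    obtain c where c: "c \<in> (\<Pi>\<^sub>E v\<in>S. edges_into G R v)" "c ` S \<subseteq> F"
      using first_layer_choice unfolding S_def by blast
    \<comment> \<open>The attached set lies in \<open>F\<close> and is a rooted forest, so it has as
      many edges as \<open>F\<close> and exhausts it.\<close>
    have "card (c ` S \<union> F1) = card F"
      using rooted_forests_attach[OF assms(1) SX assms(2,3) c(1) F1(2)] cF
      by (simp add: rooted_forests_def)
    moreover have "finite F" using FG assms finite_subset by blast
    ultimately have "F = c ` S \<union> F1" using c(2) F1(1) by (intro card_subset_eq[symmetric]) auto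
    then show "F \<in> ?f ` ?D" using SX c(1) F1(2) by (intro image_eqI[of _ _ "(S, c, F1)"]) auto
  qed
qed

text \<open>All three components can be read off the union: \<open>S\<close> is its first layer,
  \<open>F\<close> consists of its edges inside \<open>X\<close>, and \<open>c v\<close> is its only
  root edge ending at \<open>v\<close>.\<close>

lemma inj_on_attach:
  assumes "R \<inter> X = {}"
  shows "inj_on (\<lambda>(S, c, F). c ` S \<union> F)
      (SIGMA S:Pow X. (\<Pi>\<^sub>E v\<in>S. edges_into G R v) \<times> rooted_forests G S (X - S))"
    (is "inj_on ?f ?D")
proof (rule inj_onI)
  fix p q assume p: "p \<in> ?D" and q: "q \<in> ?D" and eq: "?f p = ?f q"
  obtain S c F where pe: "p = (S, c, F)" using prod_cases3 .
  obtain T d H where qe: "q = (T, d, H)" using prod_cases3 .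
  note ends = edges_into_ends[OF _ _ assms]
  have FX: "mg_ends G e \<subseteq> X" if "(S, c, F) \<in> ?D" "e \<in> F" for S c F e
    using that by (fastforce simp: rooted_forests_def)
  have cin: "c v \<in> edges_into G R v" "v \<in> X" if "(S, c, F) \<in> ?D" "v \<in> S" for S c F v
    using that by auto
  have layer: "first_layer G R X (c ` S \<union> F) = S" if D: "(S, c, F) \<in> ?D" for S c F
  proof
    show "S \<subseteq> first_layer G R X (c ` S \<union> F)"
      using cin[OF D] by (auto simp: first_layer_def)
    show "first_layer G R X (c ` S \<union> F) \<subseteq> S"
    proof
      fix v assume "v \<in> first_layer G R X (c ` S \<union> F)"
      then obtain e where v: "v \<in> X" "e \<in> c ` S \<union> F" "e \<in> edges_into G R v"
        by (auto simp: first_layer_def)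
      then have "e \<notin> F" using ends(2)[OF v(3,1)] FX[OF D, of e] by blast
      then obtain u where "u \<in> S" "e = c u" using v by auto
      then show "v \<in> S" using ends(1)[OF cin[OF D], of u] ends(1)[OF v(3,1)] by auto
    qed
  qed
  have rest: "{e \<in> c ` S \<union> F. mg_ends G e \<subseteq> X} = F" if D: "(S, c, F) \<in> ?D" for S c F
    using FX[OF D] ends(2)[OF cin[OF D]] by auto
  note p = p[unfolded pe] and q = q[unfolded qe]
  have eq: "c ` S \<union> F = d ` T \<union> H" using eq pe qe by simp
  have ST: "T = S" using layer[OF p] layer[OF q] eq by simp
  have FH: "H = F" using rest[OF p] rest[OF q] eq by simp
  note q = q[unfolded ST FH]
  have "c v = d v" if v: "v \<in> S" for v
  proof -
    have "c v \<notin> F" using ends(2)[OF cin[OF p v]] FX[OF p, of "c v"] by blast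
    then obtain u where u: "u \<in> S" "c v = d u" using eq v ST FH by blast
    then show ?thesis using ends(1)[OF cin[OF p v]] ends(1)[OF cin[OF q u(1)]] by simp
  qed
  then have "c = d" using p q by (intro PiE_ext[of c S _ d]) auto
  then show "p = q" using pe qe ST FH by simp
qed

text \<open>The product counts the choice functions \<open>c\<close>. The term for
  \<open>S = {}\<close> is nonzero only if \<open>X = {}\<close>, since without roots nothing can be
  spanned.\<close>

lemma card_rooted_forests_rec:
  assumes "R \<inter> X = {}" "finite X" "finite (mg_edges G)"
  shows "card (rooted_forests G R X) =
    (\<Sum>S\<in>Pow X. (\<Prod>v\<in>S. card (edges_into G R v)) * card (rooted_forests G S (X - S)))"
proof -
  have fin: "finite (rooted_forests G S Y)" for S Y
    by (rule finite_subset[of _ "Pow (mg_edges G)"]) (auto simp: rooted_forests_def assms(3))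
  have finS: "finite S" if "S \<in> Pow X" for S using that assms(2) finite_subset by auto
  have finE: "finite (edges_into G R v)" for v using assms(3) by (auto simp: edges_into_def)
  have "card (rooted_forests G R X) = card (SIGMA S:Pow X.
      (\<Pi>\<^sub>E v\<in>S. edges_into G R v) \<times> rooted_forests G S (X - S))"
    unfolding rooted_forests_eq_attached[OF assms] by (rule card_image[OF inj_on_attach[OF assms(1)]])
  also have "\<dots> = (\<Sum>S\<in>Pow X. card ((\<Pi>\<^sub>E v\<in>S. edges_into G R v) \<times> rooted_forests G S (X - S)))"
    using assms(2) fin finE finS by (intro card_SigmaI) (auto intro!: finite_PiE)
  finally show ?thesis using finS by (simp add: card_cartesian_product card_PiE)
qed

section \<open>Spanning trees as rooted forests\<close>

lemma rtrancl_enters: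
  assumes "(x, y) \<in> r\<^sup>*" "x \<notin> A" "y \<in> A"
  obtains p q where "(p, q) \<in> r" "p \<notin> A" "q \<in> A"
  using assms by (induction rule: rtrancl_induct) blast+

lemma rtrancl_distinct_path:
  assumes "(u, v) \<in> r\<^sup>*"
  obtains vs where "vs \<noteq> []" "hd vs = u" "last vs = v" "distinct vs"
    "successively (\<lambda>x y. (x, y) \<in> r) vs"
  using assms
proof (induction arbitrary: thesis rule: rtrancl_induct)
  case base
  show ?case by (rule base[of "[u]"]) auto
next
  case (step y z)
  obtain vs where vs: "vs \<noteq> []" "hd vs = u" "last vs = y" "distinct vs"
    "successively (\<lambda>x y. (x, y) \<in> r) vs" using step.IH .
  show ?case
  proof (cases "z \<in> set vs")
    \<comment> \<open>A walk that returns to \<open>z\<close> is cut off at the earlier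
      visit.\<close>
    case True
    then obtain ys zs where "vs = ys @ z # zs" by (meson split_list)
    then show ?thesis
      using vs by (intro step.prems[of "ys @ [z]"])
        (auto simp: successively_append_iff hd_append split: if_splits)
  next
    case False
    then show ?thesis
      using vs step.hyps by (intro step.prems[of "vs @ [z]"]) (auto simp: successively_append_iff)
  qed
qed

text \<open>A path from \<open>r\<close> into a set must enter it along some edge. Conversely, the
  set of vertices unreachable from \<open>r\<close> is left by no edge, hence empty.\<close>

lemma mg_connected_iff_spans:
  assumes "r \<in> mg_verts G" "mg_wf G" "F \<subseteq> mg_edges G"
  shows "mg_connected (G\<lparr>mg_edges := F\<rparr>) \<longleftrightarrow> spans G {r} (mg_verts G - {r}) F"
proof
  let ?H = "G\<lparr>mg_edges := F\<rparr>"
  let ?V = "mg_verts G"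
  assume con: "mg_connected ?H"
  show "spans G {r} (?V - {r}) F"
    unfolding spans_def
  proof (intro allI impI)
    fix A assume A: "A \<subseteq> ?V - {r}" "A \<noteq> {}"
    then obtain a where "a \<in> A" by auto
    then have "(r, a) \<in> (mg_adj ?H)\<^sup>*" using con A assms(1) by (auto simp: mg_connected_def)
    then obtain p q where "(p, q) \<in> mg_adj ?H" "p \<notin> A" "q \<in> A"
      using rtrancl_enters[of r a _ A] \<open>a \<in> A\<close> A by blast
    then obtain e where "e \<in> F" "mg_ends G e = {q, p}" "p \<notin> A" "q \<in> A"
      by (auto simp: mg_adj_def insert_commute)
    moreover from this have "p \<in> ?V" using assms by (auto simp: mg_wf_def)
    ultimately show "\<exists>e\<in>F. \<exists>a\<in>A. \<exists>b\<in>({r} \<union> (?V - {r})) - A. mg_ends G e = {a, b}"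
      by blast
  qed
next
  let ?H = "G\<lparr>mg_edges := F\<rparr>"
  let ?V = "mg_verts G"
  assume sp: "spans G {r} (?V - {r}) F"
  have "sym (mg_adj ?H)" by (auto simp: sym_def mg_adj_def insert_commute)
  then have sym: "sym ((mg_adj ?H)\<^sup>*)" by (rule sym_rtrancl)
  define A where "A = {v \<in> ?V. (r, v) \<notin> (mg_adj ?H)\<^sup>*}"
  have "A = {}"
  proof (rule ccontr)
    assume "A \<noteq> {}"
    moreover have "A \<subseteq> ?V - {r}" by (auto simp: A_def)
    ultimately obtain e a b where e: "e \<in> F" "a \<in> A" "b \<in> ({r} \<union> (?V - {r})) - A"
      "mg_ends G e = {a, b}"
      using sp unfolding spans_def by blast
    then have "(r, b) \<in> (mg_adj ?H)\<^sup>*" by (auto simp: A_def)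
    moreover have "(b, a) \<in> mg_adj ?H" using e by (auto simp: mg_adj_def insert_commute)
    ultimately show False using e(2) by (auto simp: A_def dest: rtrancl_into_rtrancl)
  qed
  then have "(r, v) \<in> (mg_adj ?H)\<^sup>*" if "v \<in> ?V" for v using that by (auto simp: A_def)
  then show "mg_connected ?H"
    using sym assms(1) unfolding mg_connected_def by (auto dest: symD intro: rtrancl_trans)
qed

text \<open>If the removed edge leaves \<open>A\<close>, the rest of the cycle joins its two ends
  and therefore crosses the boundary of \<open>A\<close> as well.\<close>

lemma spans_remove_cycle_edge:
  assumes "spans G R X F" "mg_verts G = R \<union> X" "mg_cycle (G\<lparr>mg_edges := F\<rparr>) vs es"
  shows "spans G R X (F - {last es})"
  unfolding spans_def
proof (intro allI impI)
  fix A assume A: "A \<subseteq> X" "A \<noteq> {}"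
  then obtain e a b where e: "e \<in> F" "a \<in> A" "b \<in> (R \<union> X) - A" "mg_ends G e = {a, b}"
    using assms(1) unfolding spans_def by blast
  show "\<exists>e\<in>F - {last es}. \<exists>a\<in>A. \<exists>b\<in>(R \<union> X) - A. mg_ends G e = {a, b}"
  proof (cases "e = last es")
    case False
    then show ?thesis using e by blast
  next
    case True
    define N where "N = length es - 1"
    have cyc: "es \<noteq> []" "length vs = length es" "distinct es" "set vs \<subseteq> R \<union> X" "set es \<subseteq> F"
      "\<And>i. i < length es \<Longrightarrow> mg_ends G (es ! i) = {vs ! i, vs ! (Suc i mod length es)}"
      using assms(2,3) by (auto simp: mg_cycle_def)
    have len: "length es = Suc N" using cyc(1) by (simp add: N_def)
    have last: "last es = es ! N" using cyc(1) by (simp add: last_conv_nth N_def)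
    \<comment> \<open>The last edge closes the cycle, as its successor index wraps around to 0. For
      a loop \<open>N = 0\<close>, and \<open>ne\<close> below is already absurd.\<close>
    have "{a, b} = {vs ! N, vs ! 0}"
      using cyc(6)[of N] e(4) True last len by simp
    then have ne: "(vs ! 0 \<in> A) \<noteq> (vs ! N \<in> A)" using e by (auto simp: doubleton_eq_iff)
    have "\<exists>i<N. (vs ! i \<in> A) \<noteq> (vs ! Suc i \<in> A)"
    proof (rule ccontr)
      assume "\<not> ?thesis"
      then have "i \<le> N \<Longrightarrow> (vs ! i \<in> A) = (vs ! 0 \<in> A)" for i by (induction i) auto
      then show False using ne by blast
    qed
    then obtain i where i: "i < N" "(vs ! i \<in> A) \<noteq> (vs ! Suc i \<in> A)" by blast
    then have "mg_ends G (es ! i) = {vs ! i, vs ! Suc i}" using cyc(6)[of i] len by simp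
    moreover have "es ! i \<in> F - {last es}"
      using i(1) cyc(3,5) len last nth_mem[of i es] by (auto simp: nth_eq_iff_index_eq)
    moreover have "vs ! i \<in> R \<union> X" "vs ! Suc i \<in> R \<union> X"
      using i(1) cyc(2) len by (simp_all add: subsetD[OF cyc(4) nth_mem] del: Un_iff)
    ultimately show ?thesis using i(2) by (cases "vs ! i \<in> A") (blast, metis DiffI insert_commute)
  qed
qed

text \<open>A simple path in \<open>F0\<close> between the ends of \<open>e\<close> is closed by
  \<open>e\<close>. A loop \<open>e\<close> gives the one-vertex path and a cycle of length 1; an
  edge parallel to one of \<open>F0\<close> can give a cycle of length 2.\<close>

lemma mg_cycle_close_path:
  assumes "mg_wf G" "F \<subseteq> mg_edges G" "e \<in> F" "F0 \<subseteq> F" "e \<notin> F0"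
    and "mg_connected (G\<lparr>mg_edges := F0\<rparr>)"
  obtains vs es where "mg_cycle (G\<lparr>mg_edges := F\<rparr>) vs es"
proof -
  let ?H = "G\<lparr>mg_edges := F0\<rparr>"
  have ends: "mg_ends G f \<subseteq> mg_verts G" "card (mg_ends G f) = 1 \<or> card (mg_ends G f) = 2"
    if "f \<in> F" for f
    using assms(1,2) that by (auto simp: mg_wf_def)
  obtain u v where uv: "mg_ends G e = {u, v}"
    using ends(2)[OF assms(3)] by (metis card_1_singletonE card_2_iff insert_absorb2)
  then have uvV: "u \<in> mg_verts G" "v \<in> mg_verts G" using ends(1)[OF assms(3)] by auto
  then have "(u, v) \<in> (mg_adj ?H)\<^sup>*" using assms(6) by (simp add: mg_connected_def)
  then obtain vs where vs: "vs \<noteq> []" "hd vs = u" "last vs = v" "distinct vs"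
    "successively (\<lambda>x y. (x, y) \<in> mg_adj ?H) vs"
    by (rule rtrancl_distinct_path)
  define N where "N = length vs - 1"
  have len: "length vs = Suc N" using vs(1) by (simp add: N_def)
  have "\<exists>f\<in>F0. mg_ends G f = {vs ! i, vs ! Suc i}" if "i < N" for i
    using vs(5) that len by (auto simp: successively_conv_nth mg_adj_def)
  then obtain f where f: "\<And>i. i < N \<Longrightarrow> f i \<in> F0 \<and> mg_ends G (f i) = {vs ! i, vs ! Suc i}"
    by metis
  define es where "es = map f [0..<N] @ [e]"
  \<comment> \<open>The vertices of the path are distinct, so different steps have different end
    sets and cannot share an edge.\<close>
  have "inj_on f {0..<N}"
  proof (rule inj_onI)
    fix i j assume ij: "i \<in> {0..<N}" "j \<in> {0..<N}" "f i = f j"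
    then have "{vs ! i, vs ! Suc i} = {vs ! j, vs ! Suc j}" using f by (metis atLeastLessThan_iff)
    then show "i = j"
      using ij vs(4) len by (auto simp: doubleton_eq_iff nth_eq_iff_index_eq)
  qed
  then have "distinct es"
    using f assms(5) by (auto simp: es_def distinct_map)
  moreover have "set vs \<subseteq> mg_verts G"
  proof
    fix x assume "x \<in> set vs"
    then obtain i where i: "i < Suc N" "x = vs ! i" using len by (metis in_set_conv_nth)
    show "x \<in> mg_verts G"
    proof (cases i)
      case 0
      then show ?thesis using i vs(1,2) uvV by (simp add: hd_conv_nth)
    next
      case (Suc j)
      then show ?thesis using f[of j] i ends(1)[of "f j"] assms(4) by auto
    qed
  qed
  moreover have "set es \<subseteq> F" using f assms(3,4) by (auto simp: es_def)
  moreover have "mg_ends G (es ! i) = {vs ! i, vs ! (Suc i mod length es)}" if "i < length es" for i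
  proof (cases "i < N")
    case True
    then show ?thesis using f by (simp add: es_def nth_append)
  next
    case False
    then have "i = N" using that by (simp add: es_def)
    then show ?thesis
      using uv vs(1-3) by (simp add: es_def nth_append hd_conv_nth last_conv_nth N_def insert_commute)
  qed
  ultimately have "mg_cycle (G\<lparr>mg_edges := F\<rparr>) vs es"
    using vs(4) len by (simp add: mg_cycle_def es_def)
  then show thesis by (rule that)
qed

text \<open>A tree contains a rooted forest, and any further edge would close a cycle. Conversely,
  dropping an edge of a cycle would leave a spanning set with fewer than \<open>card X\<close>
  edges.\<close>

lemma spanning_trees_eq_rooted_forests:
  assumes "r \<in> mg_verts G" "mg_wf G" "finite (mg_verts G)" "finite (mg_edges G)"
  shows "spanning_trees G = rooted_forests G {r} (mg_verts G - {r})"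
proof (rule set_eqI)
  fix F
  let ?X = "mg_verts G - {r}"
  have V: "mg_verts G = {r} \<union> ?X" using assms(1) by auto
  have fX: "finite ?X" "{r} \<inter> ?X = {}" using assms(3) by auto
  show "F \<in> spanning_trees G \<longleftrightarrow> F \<in> rooted_forests G {r} ?X"
  proof
    assume "F \<in> spanning_trees G"
    then have F: "F \<subseteq> mg_edges G" and con: "mg_connected (G\<lparr>mg_edges := F\<rparr>)"
      and acy: "mg_acyclic (G\<lparr>mg_edges := F\<rparr>)"
      by (auto simp: spanning_trees_def mg_tree_def)
    have "spans G {r} ?X F" using con mg_connected_iff_spans[OF assms(1,2) F] by simp
    then obtain F0 where F0: "F0 \<subseteq> F" "F0 \<in> rooted_forests G {r} ?X"
      by (rule spans_contains_rooted_forest[OF _ F fX(2,1) assms(4)])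
    then have "mg_connected (G\<lparr>mg_edges := F0\<rparr>)"
      using mg_connected_iff_spans[OF assms(1,2)] by (auto simp: rooted_forests_def)
    then have "F0 = F"
      using mg_cycle_close_path[OF assms(2) F _ F0(1)] acy F0(1) unfolding mg_acyclic_def by blast
    then show "F \<in> rooted_forests G {r} ?X" using F0 by simp
  next
    assume "F \<in> rooted_forests G {r} ?X"
    then have F: "F \<subseteq> mg_edges G" and cF: "card F = card ?X" and sp: "spans G {r} ?X F"
      by (auto simp: rooted_forests_def)
    have "mg_acyclic (G\<lparr>mg_edges := F\<rparr>)"
      unfolding mg_acyclic_def
    proof safe
      fix vs es assume cyc: "mg_cycle (G\<lparr>mg_edges := F\<rparr>) vs es"
      then have "last es \<in> F" by (auto simp: mg_cycle_def)
      then have "card (F - {last es}) < card F"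
        using F assms(4) finite_subset by (blast intro: psubset_card_mono)
      moreover have "card ?X \<le> card (F - {last es})"
        using card_le_card_spans[OF spans_remove_cycle_edge[OF sp V cyc]] F fX assms(4) by blast
      ultimately show False using cF by simp
    qed
    then show "F \<in> spanning_trees G"
      using F sp mg_connected_iff_spans[OF assms(1,2) F] by (auto simp: spanning_trees_def mg_tree_def)
  qed
qed

section \<open>Weighted complete bipartite multigraphs\<close>

lemma sum_Pow_insert:
  fixes f :: "'a set \<Rightarrow> 'b::comm_monoid_add"
  assumes "finite U" "x \<notin> U"
  shows "(\<Sum>S\<in>Pow (insert x U). f S) = (\<Sum>S\<in>Pow U. f S) + (\<Sum>S\<in>Pow U. f (insert x S))"
proof -
  have "inj_on (insert x) (Pow U)" using assms(2) by (auto simp: inj_on_def)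
  then show ?thesis
    using assms unfolding Pow_insert by (subst sum.union_disjoint) (auto simp: sum.reindex)
qed

lemma sum_Pow_binomial:
  fixes a b :: nat
  assumes "finite U"
  shows "(\<Sum>S\<in>Pow U. a ^ card S * b ^ card (U - S)) = (a + b) ^ card U"
  using prod_add[OF assms, of "\<lambda>_. a" "\<lambda>_. b"] by simp

text \<open>Each \<open>x\<close> in \<open>U\<close> contributes \<open>w x\<close> times the
  binomial sum over the sets containing it, \<open>a * (a + b) ^ (card U - 1)\<close>. The factor
  \<open>a + b\<close> on the left avoids the decremented exponent.\<close>

lemma sum_Pow_weighted_binomial:
  fixes a b :: nat and w :: "'a \<Rightarrow> nat"
  assumes "finite U"
  shows "(a + b) * (\<Sum>S\<in>Pow U. a ^ card S * b ^ card (U - S) * sum w S) = sum w U * a * (a + b) ^ card U"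
  using assms
proof induction
  case empty
  then show ?case by simp
next
  case (insert x U)
  have fin: "finite S" "x \<notin> S" "insert x U - S = insert x (U - S)" "insert x U - insert x S = U - S"
    "card (insert x (U - S)) = Suc (card (U - S))" if "S \<in> Pow U" for S
    using that insert.hyps finite_subset by auto
  let ?s = "\<Sum>S\<in>Pow U. a ^ card S * b ^ card (U - S) * sum w S"
  \<comment> \<open>Split by whether \<open>x\<close> lies in the subset; if it does,
    \<open>w x\<close> adds a plain binomial sum.\<close>
  have "(\<Sum>S\<in>Pow (insert x U). a ^ card S * b ^ card (insert x U - S) * sum w S)
      = (\<Sum>S\<in>Pow U. b * (a ^ card S * b ^ card (U - S) * sum w S))
        + (\<Sum>S\<in>Pow U. a * (a ^ card S * b ^ card (U - S) * sum w S)
           + a * w x * (a ^ card S * b ^ card (U - S)))"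
    unfolding sum_Pow_insert[OF insert.hyps]
    by (intro arg_cong2[of _ _ _ _ "(+)"] sum.cong) (auto simp: fin algebra_simps)
  also have "\<dots> = (a + b) * ?s + a * w x * (a + b) ^ card U"
    by (simp add: sum.distrib flip: sum_distrib_left sum_Pow_binomial[OF insert.hyps(1)])
      (simp add: algebra_simps)
  finally show ?case using insert by (simp add: algebra_simps)
qed

section \<open>Counting rooted forests in weighted bipartite multigraphs\<close>

definition edge_mult :: "('v, 'e) multigraph \<Rightarrow> 'v \<Rightarrow> 'v \<Rightarrow> nat" where
  "edge_mult G u v = card {e \<in> mg_edges G. mg_ends G e = {u, v}}"

text \<open>Giving weights to both sides makes the notion symmetric, so the induction can exchange
  the sides at each layer. Positivity allows cancelling the total weight of a nonempty side.\<close>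

definition weighted_bipartite ::
  "('v, 'e) multigraph \<Rightarrow> ('v \<Rightarrow> nat) \<Rightarrow> 'v set \<Rightarrow> 'v set \<Rightarrow> bool" where
  "weighted_bipartite G w A B \<longleftrightarrow> finite A \<and> finite B \<and> A \<inter> B = {} \<and> (\<forall>v\<in>A \<union> B. w v > 0) \<and>
     (\<forall>u\<in>A. \<forall>v\<in>B. edge_mult G u v = w u * w v) \<and>
     (\<forall>u\<in>A. \<forall>v\<in>A. edge_mult G u v = 0) \<and> (\<forall>u\<in>B. \<forall>v\<in>B. edge_mult G u v = 0)"

lemma edge_mult_commute: "edge_mult G u v = edge_mult G v u"
  by (simp add: edge_mult_def insert_commute)

lemma weighted_bipartite_commute: "weighted_bipartite G w A B \<Longrightarrow> weighted_bipartite G w B A"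
  unfolding weighted_bipartite_def by (metis edge_mult_commute inf_commute mult.commute sup_commute)

lemma card_edges_into:
  assumes "finite R" "finite (mg_edges G)"
  shows "card (edges_into G R v) = (\<Sum>u\<in>R. edge_mult G u v)"
proof -
  have "edges_into G R v = (\<Union>u\<in>R. {e \<in> mg_edges G. mg_ends G e = {u, v}})"
    by (auto simp: edges_into_def)
  then show ?thesis
    unfolding edge_mult_def using assms by (simp, subst card_UN_disjoint) (auto simp: doubleton_eq_iff)
qed

text \<open>Settles the empty layer in the recursion, where the set of non-roots does not shrink and
  induction gives nothing.\<close>

lemma card_rooted_forests_no_roots:
  assumes "finite X" "finite (mg_edges G)"
  shows "card (rooted_forests G {} X) = (if X = {} then 1 else 0)"
proof (cases "X = {}")
  case True
  have "finite F" if "F \<subseteq> mg_edges G" for F using that assms(2) finite_subset by blast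
  then have "rooted_forests G {} X = {{}}"
    using True by (auto simp: rooted_forests_def spans_def)
  then show ?thesis using True by simp
next
  case False
  then have "rooted_forests G {} X = {}"
    by (auto simp: rooted_forests_def spans_def)
  then show ?thesis using False by simp
qed

text \<open>
  The extra factor on the left keeps the identity valid for \<open>W = {}\<close>, where dividing it out
  would leave the exponent \<open>card W - 1\<close>.
\<close>

lemma card_rooted_forests_weighted_bipartite:
  assumes "weighted_bipartite G w A B" "finite (mg_edges G)"
    and "R \<subseteq> A" "U \<subseteq> A" "W \<subseteq> B" "R \<inter> U = {}"
  shows "(sum w R + sum w U) * card (rooted_forests G R (U \<union> W)) =
    sum w R * (sum w R + sum w U) ^ card W * sum w W ^ card U * prod w U * prod w W"
  using assms
proof (induction "card (U \<union> W)" arbitrary: A B R U W rule: less_induct)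
  case less
  note wb = less.prems(1)[unfolded weighted_bipartite_def]
  have fin: "finite R" "finite U" "finite W" "R \<inter> (U \<union> W) = {}" "U \<inter> W = {}"
    using wb less.prems finite_subset by auto
  define s b M where sbM: "s = sum w R" "b = sum w U" "M = sum w W"
  have into_W: "card (edges_into G R v) = s * w v" if "v \<in> W" for v
    unfolding card_edges_into[OF fin(1) less.prems(2)] sbM sum_distrib_right
    using that wb less.prems(3,5) by (intro sum.cong) blast+
  have into_U: "card (edges_into G R v) = 0" if "v \<in> U" for v
    unfolding card_edges_into[OF fin(1) less.prems(2)]
    using that wb less.prems(3,4) by (intro sum.neutral) blast
  have "card (rooted_forests G R (U \<union> W)) = (\<Sum>S\<in>Pow (U \<union> W).
      (\<Prod>v\<in>S. card (edges_into G R v)) * card (rooted_forests G S (U \<union> W - S)))"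
    using fin less.prems(2) by (intro card_rooted_forests_rec) auto
  \<comment> \<open>The roots lie on the side of \<open>U\<close>, so no edge joins them to
    \<open>U\<close> and the first layer must lie in \<open>W\<close>.\<close>
  also have "\<dots> = (\<Sum>S\<in>Pow W.
      (\<Prod>v\<in>S. card (edges_into G R v)) * card (rooted_forests G S (U \<union> W - S)))"
  proof (rule sum.mono_neutral_right)
    show "\<forall>S\<in>Pow (U \<union> W) - Pow W.
        (\<Prod>v\<in>S. card (edges_into G R v)) * card (rooted_forests G S (U \<union> W - S)) = 0"
    proof
      fix S assume S: "S \<in> Pow (U \<union> W) - Pow W"
      then obtain v where v: "v \<in> S" "v \<in> U" by auto
      have "finite S" using S fin finite_subset[of S "U \<union> W"] by auto
      then have "(\<Prod>v\<in>S. card (edges_into G R v)) = 0"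
        using into_U v by (intro prod_zero) auto
      then show "(\<Prod>v\<in>S. card (edges_into G R v)) * card (rooted_forests G S (U \<union> W - S)) = 0"
        by simp
    qed
  qed (use fin in auto)
  also have "\<dots> = (\<Sum>T\<in>Pow W. s ^ card T * prod w T * card (rooted_forests G T ((W - T) \<union> U)))"
  proof (rule sum.cong)
    fix T assume T: "T \<in> Pow W"
    have "(\<Prod>v\<in>T. card (edges_into G R v)) = (\<Prod>v\<in>T. s * w v)"
      using T into_W by (intro prod.cong) auto
    moreover have "U \<union> W - T = (W - T) \<union> U" using T fin by auto
    ultimately show "(\<Prod>v\<in>T. card (edges_into G R v)) * card (rooted_forests G T (U \<union> W - T))
        = s ^ card T * prod w T * card (rooted_forests G T ((W - T) \<union> U))"
      by (simp add: prod.distrib)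
  qed simp
  finally have rec: "card (rooted_forests G R (U \<union> W)) =
      (\<Sum>T\<in>Pow W. s ^ card T * prod w T * card (rooted_forests G T ((W - T) \<union> U)))" .
  show ?case
  proof (cases "W = {}")
    case True
    \<comment> \<open>Only the empty layer remains. For nonempty \<open>U\<close> both sides vanish,
      the right one through \<open>0 ^ card U\<close>; for empty \<open>U\<close> both equal
      \<open>sum w R\<close>.\<close>
    then show ?thesis
      using rec fin(2) less.prems(2) by (simp add: card_rooted_forests_no_roots card_gt_0_iff)
  next
    case False
    have "M > 0" unfolding sbM
      using False fin wb less.prems(5) by (intro sum_pos) blast+
    \<comment> \<open>The sides are swapped: \<open>T\<close> is the root set, \<open>W - T\<close>
      plays the role of \<open>U\<close>, and \<open>U\<close> that of \<open>W\<close>. The weights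
      of \<open>T\<close> and \<open>W - T\<close> add up to \<open>M\<close> for every
      \<open>T\<close>, so the factor on the left is constant.\<close>
    have IH: "M * card (rooted_forests G T ((W - T) \<union> U)) =
        sum w T * M ^ card U * b ^ card (W - T) * prod w (W - T) * prod w U"
      if T: "T \<in> Pow W" for T
    proof (cases "T = {}")
      case True
      then show ?thesis
        using False fin less.prems(2) by (simp add: card_rooted_forests_no_roots)
    next
      case False
      have M: "sum w T + sum w (W - T) = M"
        using T fin sum.subset_diff[of T W w] by (simp add: sbM)
      have "card ((W - T) \<union> U) < card (U \<union> W)"
        using False T fin by (intro psubset_card_mono) auto
      then show ?thesis
        using less.hyps[OF _ weighted_bipartite_commute[OF less.prems(1)] less.prems(2), of "W - T" U T]
          T less.prems unfolding M by (auto simp: sbM)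
    qed
    let ?C = "M ^ card U * prod w U * prod w W"
    have "M * card (rooted_forests G R (U \<union> W)) =
        (\<Sum>T\<in>Pow W. s ^ card T * prod w T * (M * card (rooted_forests G T ((W - T) \<union> U))))"
      unfolding rec by (simp add: sum_distrib_left ac_simps)
    also have "\<dots> = (\<Sum>T\<in>Pow W. ?C * (s ^ card T * b ^ card (W - T) * sum w T))"
    proof (rule sum.cong)
      fix T assume T: "T \<in> Pow W"
      then have "prod w W = prod w T * prod w (W - T)"
        using fin prod.subset_diff[of T W w] by simp
      then show "s ^ card T * prod w T * (M * card (rooted_forests G T ((W - T) \<union> U)))
          = ?C * (s ^ card T * b ^ card (W - T) * sum w T)"
        unfolding IH[OF T] by simp
    qed simp
    also have "\<dots> = ?C * (\<Sum>T\<in>Pow W. s ^ card T * b ^ card (W - T) * sum w T)"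
      by (simp add: sum_distrib_left)
    \<comment> \<open>The factor \<open>s + b\<close> brings the sum into the form of the weighted
      binomial identity; its value supplies another \<open>M\<close>, so that the \<open>M\<close>
      on the left can be cancelled.\<close>
    finally have "M * ((s + b) * card (rooted_forests G R (U \<union> W))) =
        ?C * ((s + b) * (\<Sum>T\<in>Pow W. s ^ card T * b ^ card (W - T) * sum w T))"
      by (simp only: mult.left_commute[of _ "s + b"])
    also have "\<dots> = ?C * (M * s * (s + b) ^ card W)"
      unfolding sum_Pow_weighted_binomial[OF fin(3)] by (simp add: sbM)
    also have "\<dots> = M * (s * (s + b) ^ card W * M ^ card U * prod w U * prod w W)"
      by simp
    finally show ?thesis using \<open>M > 0\<close> by (simp add: sbM)
  qed
qed

section \<open>The generalized complete bipartite graph\<close>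

lemma weighted_bipartite_gen_complete_bipartite:
  assumes "\<And>i. i \<in> {1..m} \<Longrightarrow> k i \<ge> 1"
  shows "weighted_bipartite (gen_complete_bipartite k m n)
    (case_bivertex (\<lambda>_. 1) k) (QVert ` {1..m}) (PVert ` {1..n})"
proof -
  let ?G = "gen_complete_bipartite k m n"
  \<comment> \<open>The multiplicity factors as \<open>k i * 1\<close>, with weight
    \<open>k i\<close> on \<open>QVert i\<close> and weight 1 on \<open>PVert j\<close>.\<close>
  have "edge_mult ?G (QVert i) (PVert j) = k i" if "i \<in> {1..m}" "j \<in> {1..n}" for i j
    unfolding edge_mult_def using card_parallel_edges[OF that] .
  moreover have "edge_mult ?G (QVert i) (QVert j) = 0" "edge_mult ?G (PVert i) (PVert j) = 0" for i j
    by (auto simp: edge_mult_def gen_complete_bipartite_def doubleton_eq_iff card_eq_0_iff)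
  moreover have "k i > 0" if "i \<in> {1..m}" for i using assms[OF that] by simp
  ultimately show ?thesis
    unfolding weighted_bipartite_def by auto
qed

theorem theorem4p2:
  fixes m n :: nat and k :: "nat \<Rightarrow> nat"
  assumes "m \<ge> 1" and "n \<ge> 1" and "\<And>i. i \<in> {1..m} \<Longrightarrow> k i \<ge> 1"
  shows "num_spanning_trees (gen_complete_bipartite k m n)
         = n ^ (m - 1) * (\<Prod>i=1..m. k i) * (\<Sum>i=1..m. k i) ^ (n - 1)"
proof -
  let ?G = "gen_complete_bipartite k m n"
  let ?w = "case_bivertex (\<lambda>_. 1) k"
  \<comment> \<open>The root is \<open>QVert 1\<close>, which exists because
    \<open>m \<ge> 1\<close>; \<open>?U\<close> is the rest of its side.\<close>
  let ?U = "QVert ` {2..m}" and ?W = "PVert ` {1..n}"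
  have m: "{1..m} = insert 1 {2..m}" using assms(1) by auto
  have "mg_edges ?G = (SIGMA i:{1..m}. {1..n} \<times> {1..k i})"
    by (auto simp: gen_complete_bipartite_def)
  then have finE: "finite (mg_edges ?G)" by simp
  have V: "mg_verts ?G = ?W \<union> QVert ` {1..m}" by (simp add: gen_complete_bipartite_def)
  have "mg_verts ?G - {QVert 1} = ?U \<union> ?W" unfolding V m by auto
  moreover have "QVert 1 \<in> mg_verts ?G" unfolding V m by simp
  moreover have "finite (mg_verts ?G)" unfolding V by simp
  ultimately have "spanning_trees ?G = rooted_forests ?G {QVert 1} (?U \<union> ?W)"
    using spanning_trees_eq_rooted_forests[of "QVert 1" ?G] finE
      mg_wf_gen_complete_bipartite[of k m n] by simp
  then have t: "num_spanning_trees ?G = card (rooted_forests ?G {QVert 1} (?U \<union> ?W))"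
    by (simp add: num_spanning_trees_def)
  have inj: "inj_on QVert I" "inj_on PVert I" for I by (auto simp: inj_on_def)
  have sums: "sum ?w ?U = (\<Sum>i=2..m. k i)" "prod ?w ?U = (\<Prod>i=2..m. k i)"
    "sum ?w ?W = n" "prod ?w ?W = 1" "card ?U = m - 1" "card ?W = n"
    by (simp_all add: inj sum.reindex prod.reindex card_image)
  define K where "K = (\<Sum>i=1..m. k i)"
  have K: "K = k 1 + (\<Sum>i=2..m. k i)" and P: "(\<Prod>i=1..m. k i) = k 1 * (\<Prod>i=2..m. k i)"
    unfolding K_def m by simp_all
  have "K > 0" using K assms(1) assms(3)[of 1] by simp
  have sub: "{QVert 1} \<subseteq> QVert ` {1..m}" "?U \<subseteq> QVert ` {1..m}" "{QVert 1} \<inter> ?U = {}"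
    unfolding m by auto
  \<comment> \<open>In the product formula the root weight is \<open>k 1\<close>, the weight of the
    root's whole side is \<open>K\<close>, and the other side has weight \<open>n\<close>.\<close>
  have "K * num_spanning_trees ?G = k 1 * K ^ n * n ^ (m - 1) * (\<Prod>i=2..m. k i)"
    using card_rooted_forests_weighted_bipartite[OF
        weighted_bipartite_gen_complete_bipartite[OF assms(3), where n = n] finE
        sub(1,2) subset_refl sub(3)]
    unfolding t sums by (simp add: K)
  \<comment> \<open>As \<open>n \<ge> 1\<close>, one factor \<open>K\<close> splits off and cancels
    against the left side.\<close>
  also have "K ^ n = K * K ^ (n - 1)" using assms(2) by (simp flip: power_Suc)
  finally have "K * num_spanning_trees ?G
      = K * (n ^ (m - 1) * (\<Prod>i=1..m. k i) * K ^ (n - 1))"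
    unfolding P by (simp only: ac_simps)
  then have "num_spanning_trees ?G = n ^ (m - 1) * (\<Prod>i=1..m. k i) * K ^ (n - 1)"
    using \<open>K > 0\<close> by simp
  then show ?thesis unfolding K_def .
qed

end
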